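(* Consider the algorithm described in the context, which converts a finite set of $N$ sample points in $\mathbb{R}^n$ into a halfspace representation of their convex hull, under the cost model stated in the context. Let $N$ denote the number of boundary samples, $n$ the state dimension, and $J$ the number of facets of the resulting polytope. Then for two- and three-dimensional state spaces ($n\in\{2,3\}$) the algorithm has runtime complexity $$\mathcal{O}\left(n^2N + N^2 + nN + Jn^3\right).$$ For higher-dimensional state spaces, the worst-case complexity of the convex hull computation (step 2 of the algorithm) is bounded by $$\mathcal{O}\left(N^{\lfloor n/2 \rfloor}\right).$$
   Context: Algorithm. Input: a finite set $\mathcal{S}=\{x_1,\dots,x_N\}\subset\mathbb{R}^n$ with $N\ge n+1$. Output: $A_{\mathcal{P}}\in\mathbb{R}^{J\times n}$ and $b_{\mathcal{P}}\in\mathbb{R}^J$ with $\mathcal{P}:=\mathrm{conv}(\mathcal{S})=\{x\in\mathbb{R}^n \mid A_{\mathcal{P}}x\le b_{\mathcal{P}}\}$. 1. Verify that $\dim(\mathrm{aff}(\mathcal{S}))=n$, by computing the rank of $[x_2-x_1,\dots,x_N-x_1]\in\mathbb{R}^{n\times(N-1)}$; if not, terminate. 2. Determine the number $J$ of facets of $\mathcal{P}$ and, for each facet $\mathcal{F}_j(\mathcal{P})$, $j=1,\dots,J$, its vertex set $\mathcal{V}_j(\mathcal{P})\subset\mathcal{S}$, using a QuickHull algorithm. 3. Compute the centroid $c=\frac1N\sum_{i=1}^Nx_i$. 4. For each $j=1,\dots,J$: (a) compute a normal vector $a_j$ to $\mathcal{F}_j(\mathcal{P})$ from its vertices; (b)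 compute $b_j=a_j^\top v$ for some $v\in\mathcal{V}_j(\mathcal{P})$; (c) if $a_j^\top c>b_j$, replace $a_j\gets-a_j$, $b_j\gets-b_j$. 5. Return $A_{\mathcal{P}}=[a_1,\dots,a_J]^\top$ and $b_{\mathcal{P}}=[b_1,\dots,b_J]^\top$. Cost model (classical dense linear algebra, counting floating point operations): a dot product in $\mathbb{R}^n$ costs $\mathcal{O}(n)$, dense matrix-vector products cost $\mathcal{O}(n^2)$, dense matrix-matrix products and factorizations of $n\times n$ matrices cost $\mathcal{O}(n^3)$; the rank computation of the $n\times(N-1)$ matrix by SVD or QR costs $\mathcal{O}(n^2N)$; the computation of a facet normal costs $\mathcal{O}(n^3)$. The worst-case cost of QuickHull on $N$ points, all of which may be vertices of the hull, is taken to be $\mathcal{O}(N^2)$ for $n=2,3$, and for higher $n$ to grow with the number of facets $J$, which by the Upper Bound Theorem can scale as $\mathcal{O}(N^{\lfloor n/2\rfloor})$. *)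

theory Defs
  imports "HOL-Analysis.Analysis" "HOL-Library.Landau_Symbols" "HOL-Library.Monad_Syntax"
begin

section \<open>Computations that count floating point operations\<close>

type_synonym 'a timed = "'a \<times> nat"

definition flops :: "nat \<Rightarrow> 'a \<Rightarrow> 'a timed" where
  "flops k x = (x, k)"

definition bind_timed :: "'a timed \<Rightarrow> ('a \<Rightarrow> 'b timed) \<Rightarrow> 'b timed" where
  "bind_timed m f = (let (x, s) = m; (y, t) = f x in (y, s + t))"

adhoc_overloading Monad_Syntax.bind \<rightleftharpoons> bind_timed

abbreviation result :: "'a timed \<Rightarrow> 'a" where
  "result \<equiv> fst"

abbreviation cost :: "'a timed \<Rightarrow> nat" where
  "cost \<equiv> snd"

primrec map_timed :: "('a \<Rightarrow> 'b timed) \<Rightarrow> 'a list \<Rightarrow> 'b list timed" where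
  "map_timed f [] = flops 0 []"
| "map_timed f (x # xs) = do { y \<leftarrow> f x; ys \<leftarrow> map_timed f xs; flops 0 (y # ys) }"


section \<open>Sample sets and their polytopes\<close>

text \<open>A finite set of points is given by an enumeration without repetitions, so the number of
  samples is the length of the list.\<close>

definition samples :: "(real^'n) list set" where
  "samples = {xs. distinct xs \<and> length xs \<ge> CARD('n) + 1}"

definition full_samples :: "(real^'n) list set" where
  "full_samples = {xs \<in> samples. aff_dim (set xs) = int CARD('n)}"

definition facets :: "(real^'n) list \<Rightarrow> (real^'n) set set" where
  "facets xs = {F. F facet_of (convex hull (set xs))}"

definition num_facets :: "(real^'n) list \<Rightarrow> nat" where
  "num_facets xs = card (facets xs)"

text \<open>The set below is finite, since a hull of \<open>N\<close> points has at most \<open>2 ^ N\<close> facets, and it is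
  nonempty for \<open>N \<ge> CARD('n) + 1\<close>.\<close>

definition max_facets :: "'n::finite itself \<Rightarrow> nat \<Rightarrow> nat" where
  "max_facets _ N = Max {num_facets xs | xs :: (real^'n) list. xs \<in> full_samples \<and> length xs = N}"

definition vertex_list :: "(real^'n) set \<Rightarrow> (real^'n) list \<Rightarrow> bool" where
  "vertex_list F V \<longleftrightarrow> distinct V \<and> set V = {v. v extreme_point_of F}"

definition facet_vertex_lists :: "(real^'n) list set" where
  "facet_vertex_lists = {V. \<exists>xs \<in> full_samples. \<exists>F \<in> facets xs. vertex_list F V}"


section \<open>The algorithm\<close>

text \<open>The subroutines return their result together with the number of operations spent. The argument
  of \<open>matrix_rank\<close> is the list of columns of the matrix.\<close>

record ('n::finite) routines =
  dot_product :: "real^'n \<Rightarrow> real^'n \<Rightarrow> real timed"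
  matrix_rank :: "(real^'n) list \<Rightarrow> nat timed"
  quickhull :: "(real^'n) list \<Rightarrow> (real^'n) list list timed"
  facet_normal :: "(real^'n) list \<Rightarrow> (real^'n) timed"

definition vec_sub :: "real^'n \<Rightarrow> real^'n \<Rightarrow> (real^'n) timed" where
  "vec_sub x y = flops CARD('n) (x - y)"

primrec vec_sum :: "(real^'n) list \<Rightarrow> (real^'n) timed" where
  "vec_sum [] = flops 0 0"
| "vec_sum (x # xs) = do { s \<leftarrow> vec_sum xs; flops CARD('n) (x + s) }"

definition centroid :: "(real^'n) list \<Rightarrow> (real^'n) timed" where
  "centroid xs = do { s \<leftarrow> vec_sum xs; flops CARD('n) (s /\<^sub>R real (length xs)) }"

definition differences :: "(real^'n) list \<Rightarrow> (real^'n) list timed" where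
  "differences xs = map_timed (\<lambda>x. vec_sub x (hd xs)) (tl xs)"

text \<open>The test \<open>d > b\<close> counts as one operation, and so does the negation of each entry.\<close>

definition halfspace :: "('n::finite) routines \<Rightarrow> real^'n \<Rightarrow> (real^'n) list \<Rightarrow> ((real^'n) \<times> real) timed" where
  "halfspace R c V = do {
     a \<leftarrow> facet_normal R V;
     b \<leftarrow> dot_product R a (hd V);
     d \<leftarrow> dot_product R a c;
     flip \<leftarrow> flops 1 (d > b);
     if flip then flops (CARD('n) + 1) (- a, - b) else flops 0 (a, b)
   }"

text \<open>\<open>None\<close> signals termination because the points are not full-dimensional. Otherwise the result
  consists of the rows of the matrix and of the right-hand side.\<close>

definition halfspace_representation ::
    "('n::finite) routines \<Rightarrow> (real^'n) list \<Rightarrow> ((real^'n) list \<times> real list) option timed" where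
  "halfspace_representation R xs = do {
     ds \<leftarrow> differences xs;
     r \<leftarrow> matrix_rank R ds;
     if r \<noteq> CARD('n) then flops 0 None
     else do {
       Vs \<leftarrow> quickhull R xs;
       c \<leftarrow> centroid xs;
       rows \<leftarrow> map_timed (halfspace R c) Vs;
       flops 0 (Some (map fst rows, map snd rows))
     }
   }"


section \<open>Specification and cost model of the subroutines\<close>

text \<open>\<open>dim\<close> is the dimension of the linear span, hence the rank of the matrix with these columns.\<close>

definition correct_routines :: "('n::finite) routines \<Rightarrow> bool" where
  "correct_routines R \<longleftrightarrow>
     (\<forall>x y. result (dot_product R x y) = x \<bullet> y) \<and>
     (\<forall>ds. result (matrix_rank R ds) = dim (set ds)) \<and>
     (\<forall>xs \<in> full_samples. \<exists>Fs. distinct Fs \<and> set Fs = facets xs \<and>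
        list_all2 vertex_list Fs (result (quickhull R xs))) \<and>
     (\<forall>V \<in> facet_vertex_lists. result (facet_normal R V) \<noteq> 0 \<and>
        (\<forall>v \<in> set V. \<forall>w \<in> set V. result (facet_normal R V) \<bullet> (v - w) = 0))"

text \<open>\<open>O[principal A]\<close> is a bound on all of \<open>A\<close> with one constant. The facet count that bounds
  the worst-case cost of \<open>quickhull\<close> is the worst one for the same number of points: on a particular
  input the cost can exceed the number of facets by far, as not all points need be vertices.\<close>

definition cost_model :: "('n::finite) routines \<Rightarrow> bool" where
  "cost_model R \<longleftrightarrow>
     (\<lambda>(x, y). real (cost (dot_product R x y))) \<in> O[principal UNIV](\<lambda>_. real CARD('n)) \<and>
     (\<lambda>xs. real (cost (matrix_rank R (result (differences xs)))))
        \<in> O[principal samples](\<lambda>xs. real CARD('n) ^ 2 * real (length xs)) \<and>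
     (\<lambda>V. real (cost (facet_normal R V)))
        \<in> O[principal facet_vertex_lists](\<lambda>_. real CARD('n) ^ 3) \<and>
     (CARD('n) \<in> {2, 3} \<longrightarrow>
        (\<lambda>xs. real (cost (quickhull R xs)))
          \<in> O[principal full_samples](\<lambda>xs. real (length xs) ^ 2)) \<and>
     (CARD('n) > 3 \<longrightarrow>
        (\<lambda>xs. real (cost (quickhull R xs)))
          \<in> O[principal full_samples](\<lambda>xs. real (max_facets TYPE('n) (length xs))))"

end

theory Submission
  imports Defs
begin

text \<open>The statement for \<open>n \<in> {2, 3}\<close> is bookkeeping: the differences and the centroid cost
  \<open>O(n N)\<close>, the rank \<open>O(n^2 N)\<close>, the hull \<open>O(N^2)\<close>, and each of the \<open>J\<close> facets costs \<open>O(n^3)\<close> for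
  its normal vector, which dominates two dot products and a possible change of sign.

  The statement for \<open>n > 3\<close> is the asymptotic Upper Bound Theorem: a polytope spanned by \<open>N\<close> points
  in \<open>n\<close>-space has \<open>O(N^(n div 2))\<close> facets. Place the origin in the interior of the polytope.
  A facet is then cut out by an equation \<open>y \<bullet> x = 1\<close> for which all the points \<open>v\<close> satisfy
  \<open>y \<bullet> v \<le> 1\<close>, and the points with equality span the space; in other words, facets are vertices \<open>y\<close>
  of the polar polyhedron (\<open>facet_polar_vertex\<close>). Fix one generic vector \<open>c\<close>. At a vertex \<open>y\<close> choose
  a basis \<open>B\<close> among the points with equality and write \<open>c\<close> as a linear combination of \<open>B\<close>. All
  coefficients are nonzero, so either at most \<open>n div 2\<close> of them are negative or at most \<open>n div 2\<close>
  are positive. Let \<open>K\<close> consist of the points with a coefficient of the rarer sign. On the face of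
  the polar polyhedron where the constraints of \<open>K\<close> are tight, \<open>c\<close> is a constant plus a combination
  of the remaining constraints with coefficients of a single sign, so \<open>y\<close> is its unique maximum or
  unique minimum there (\<open>polar_vertex_determined\<close>). Hence \<open>y\<close> is determined by \<open>K\<close> and a sign, which
  leaves at most twice as many facets as there are sets of at most \<open>n div 2\<close> points
  (\<open>polar_vertices_bound\<close>).\<close>

section \<open>Bounding the number of facets\<close>

text \<open>Source of the generic vector: proper subspaces are null sets, so finitely many of them do not
  cover the space.\<close>

lemma exists_avoiding_proper_spans:
  fixes T :: "'a::euclidean_space set"
  assumes "finite T"
  obtains c where "\<And>A. A \<subseteq> T \<Longrightarrow> span A \<noteq> UNIV \<Longrightarrow> c \<notin> span A"
proof -
  let ?U = "\<Union>A \<in> {A. A \<subseteq> T \<and> span A \<noteq> UNIV}. span A"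
  have "negligible ?U"
  proof (rule negligible_Union)
    show "finite (span ` {A. A \<subseteq> T \<and> span A \<noteq> UNIV})"
      using assms by simp
  next
    fix X assume "X \<in> span ` {A. A \<subseteq> T \<and> span A \<noteq> UNIV}"
    then obtain A where A: "X = span A" "span A \<noteq> UNIV" by auto
    then have "dim (span A) < DIM('a)"
      by (metis dim_eq_full dim_span dim_subset_UNIV le_neq_implies_less)
    then show "negligible X"
      using A negligible_lowdim by blast
  qed
  then have "?U \<noteq> UNIV"
    using non_negligible_UNIV by metis
  then show thesis
    using that by blast
qed

text \<open>These are the vertices of the polyhedron of all \<open>y\<close> with \<open>y \<bullet> x \<le> 1\<close> for \<open>x \<in> T\<close>: a feasible
  point is a vertex if and only if its tight constraints have full rank.\<close>

definition polar_vertices :: "'a::euclidean_space set \<Rightarrow> 'a set" where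
  "polar_vertices T = {y. (\<forall>x\<in>T. y \<bullet> x \<le> 1) \<and> span {x\<in>T. y \<bullet> x = 1} = UNIV}"

text \<open>Linear programming duality with the multipliers \<^term>\<open>l\<close>: the gap between the objective values
  is \<^term>\<open>\<Sum>v\<in>B. l v * (1 - y' \<bullet> v)\<close>. The terms in \<^term>\<open>K\<close> vanish whatever the sign of their
  multipliers, and the others are nonnegative. If the gap is zero, then \<^term>\<open>y'\<close> is tight on all of
  \<^term>\<open>B\<close>, which spans the space and so leaves only one candidate.\<close>

lemma polar_vertex_determined:
  fixes c y y' :: "'a::euclidean_space"
  assumes fin: "finite B" and span: "span B = UNIV"
    and c: "c = (\<Sum>v\<in>B. l v *\<^sub>R v)"
    and tight: "\<And>v. v \<in> B \<Longrightarrow> y \<bullet> v = 1"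
    and feasible: "\<And>v. v \<in> B \<Longrightarrow> y' \<bullet> v \<le> 1"
    and tight': "\<And>v. v \<in> K \<Longrightarrow> y' \<bullet> v = 1"
    and pos: "\<And>v. v \<in> B - K \<Longrightarrow> l v > 0"
  shows "c \<bullet> y' \<le> c \<bullet> y" and "c \<bullet> y' = c \<bullet> y \<Longrightarrow> y' = y"
proof -
  have expand: "c \<bullet> x = (\<Sum>v\<in>B. l v * (x \<bullet> v))" for x
    unfolding c inner_sum_left by (simp add: inner_commute)
  have diff: "c \<bullet> y - c \<bullet> y' = (\<Sum>v\<in>B. l v * (1 - y' \<bullet> v))"
    by (simp add: expand tight sum_subtractf[symmetric] right_diff_distrib)
  have nonneg: "l v * (1 - y' \<bullet> v) \<ge> 0" if "v \<in> B" for v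
    using that pos[of v] feasible[of v] tight'[of v] by (cases "v \<in> K") auto
  show "c \<bullet> y' \<le> c \<bullet> y"
    using sum_nonneg[of B "\<lambda>v. l v * (1 - y' \<bullet> v)"] nonneg diff by simp
  show "y' = y" if eq: "c \<bullet> y' = c \<bullet> y"
  proof -
    have zero: "l v * (1 - y' \<bullet> v) = 0" if "v \<in> B" for v
      using sum_nonneg_eq_0_iff[OF fin nonneg] diff eq that by auto
    have "(y' - y) \<bullet> v = 0" if "v \<in> B" for v
      using zero[OF that] pos[of v] tight'[of v] tight[OF that] that
      by (cases "v \<in> K") (auto simp: inner_diff_left)
    then have "(y' - y) \<bullet> x = 0" if "x \<in> span B" for x
      using orthogonal_to_span[OF that, of "y' - y"] by (simp add: orthogonal_def)
    then have "(y' - y) \<bullet> (y' - y) = 0"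
      using span by blast
    then show ?thesis by simp
  qed
qed

text \<open>This adapts Seidel's counting argument for simple polyhedra. There the basis \<open>B\<close> is the set of all
  tight constraints; at a degenerate vertex any basis among them serves equally well, so the count is
  valid for points in arbitrary position.\<close>

lemma polar_vertices_bound:
  fixes T :: "'a::euclidean_space set"
  assumes T: "finite T"
  shows "finite (polar_vertices T)"
    and "card (polar_vertices T) \<le> 2 * card {K. K \<subseteq> T \<and> card K \<le> DIM('a) div 2}"
proof -
  define Y where "Y = polar_vertices T"
  obtain c where c: "\<And>A. A \<subseteq> T \<Longrightarrow> span A \<noteq> UNIV \<Longrightarrow> c \<notin> span A"
    using exists_avoiding_proper_spans[OF T] by blast
  let ?S = "{K. K \<subseteq> T \<and> card K \<le> DIM('a) div 2}"
  \<comment> \<open>Being a maximum for \<open>s = 1\<close> and a minimum for \<open>s = -1\<close>; the pair of \<open>s\<close> and \<open>K\<close> is the label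
    of \<open>y\<close>.\<close>
  define opt :: "'a \<Rightarrow> real \<Rightarrow> 'a set \<Rightarrow> bool" where
    "opt y s K \<longleftrightarrow> (\<forall>x\<in>K. y \<bullet> x = 1) \<and>
       (\<forall>y'\<in>Y. (\<forall>x\<in>K. y' \<bullet> x = 1) \<longrightarrow>
          s * (c \<bullet> y') \<le> s * (c \<bullet> y) \<and> (s * (c \<bullet> y') = s * (c \<bullet> y) \<longrightarrow> y' = y))" for y s K
  have ex: "\<exists>s K. s \<in> {1, -1} \<and> K \<in> ?S \<and> opt y s K" if "y \<in> Y" for y
  proof -
    let ?A = "{x\<in>T. y \<bullet> x = 1}"
    have spanA: "span ?A = UNIV"
      using that by (simp add: Y_def polar_vertices_def)
    obtain B where B: "B \<subseteq> ?A" "independent B" "?A \<subseteq> span B" "card B = dim ?A"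
      using basis_exists[of ?A] by blast
    have finB: "finite B"
      using B(1) T finite_subset by fastforce
    have spanB: "span B = UNIV"
      using span_minimal[OF B(3) subspace_span] spanA by auto
    have cardB: "card B = DIM('a)"
      using B(4) spanA by (metis dim_span dim_UNIV)
    obtain l where l: "c = (\<Sum>v\<in>B. l v *\<^sub>R v)"
      using spanB span_finite[OF finB] by auto
    have nz: "l v \<noteq> 0" if v: "v \<in> B" for v
    proof
      assume "l v = 0"
      then have "c = (\<Sum>v\<in>B - {v}. l v *\<^sub>R v)"
        using l sum.remove[OF finB v, of "\<lambda>v. l v *\<^sub>R v"] by simp
      then have "c \<in> span (B - {v})"
        by (auto intro!: span_sum span_scale intro: span_base)
      moreover have "v \<notin> span (B - {v})"
        using B(2) v dependent_def by blast
      \<comment> \<open>So \<open>c\<close> would lie in a proper subspace spanned by points of \<open>T\<close>.\<close>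
      ultimately show False
        using c[of "B - {v}"] B(1) by auto
    qed
    define P where "P = {v\<in>B. l v > 0}"
    define M where "M = {v\<in>B. l v < 0}"
    have split: "B = P \<union> M" "P \<inter> M = {}"
      using nz by (auto simp: P_def M_def neq_iff)
    have sub: "P \<subseteq> T" "M \<subseteq> T"
      using B(1) by (auto simp: P_def M_def)
    have card: "card P + card M = DIM('a)"
      using cardB finB split by (metis card_Un_disjoint finite_Un)
    have optI: "opt y s K"
      if K: "K \<subseteq> B" and pos: "\<And>v. v \<in> B - K \<Longrightarrow> s * l v > 0" for s K
    proof -
      have sc: "s *\<^sub>R c = (\<Sum>v\<in>B. (s * l v) *\<^sub>R v)"
        by (simp add: l scaleR_sum_right)
      have tight: "y \<bullet> v = 1" if "v \<in> B" for v
        using that B(1) by auto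
      have feas: "y' \<bullet> v \<le> 1" if "y' \<in> Y" "v \<in> B" for v y'
        using that B(1) by (auto simp: Y_def polar_vertices_def)
      have "s * (c \<bullet> y') \<le> s * (c \<bullet> y) \<and> (s * (c \<bullet> y') = s * (c \<bullet> y) \<longrightarrow> y' = y)"
        if y': "y' \<in> Y" and tight': "\<forall>x\<in>K. y' \<bullet> x = 1" for y'
        using polar_vertex_determined[where K = K and y = y and y' = y',
            OF finB spanB sc tight feas[OF y'] bspec[OF tight'] pos] by simp
      then show ?thesis
        unfolding opt_def using K tight by blast
    qed
    show ?thesis
    proof (cases "card M \<le> DIM('a) div 2")
      case True
      have "opt y 1 M" by (rule optI) (use nz in \<open>auto simp: M_def neq_iff\<close>)
      then show ?thesis using True sub by blast
    next
      case False
      then have "card P \<le> DIM('a) div 2" using card by linarith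
      moreover have "opt y (-1) P" by (rule optI) (use nz in \<open>auto simp: P_def neq_iff\<close>)
      ultimately show ?thesis using sub by blast
    qed
  qed
  have uniq: "y = y'" if "opt y s K" "opt y' s K" "y \<in> Y" "y' \<in> Y" for y y' s K
    using that unfolding opt_def by (metis order_antisym)
  have "\<forall>y\<in>Y. \<exists>p. fst p \<in> {1, -1} \<and> snd p \<in> ?S \<and> opt y (fst p) (snd p)"
    using ex by fastforce
  then obtain f where f: "\<forall>y\<in>Y. fst (f y) \<in> {1, -1} \<and> snd (f y) \<in> ?S \<and> opt y (fst (f y)) (snd (f y))"
    by (rule bchoice[THEN exE])
  have inj: "inj_on f Y"
  proof (rule inj_onI)
    fix y y' assume *: "y \<in> Y" "y' \<in> Y" "f y = f y'"
    have "opt y (fst (f y)) (snd (f y))" "opt y' (fst (f y')) (snd (f y'))"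
      using f *(1,2) by blast+
    then show "y = y'"
      using uniq[of y "fst (f y)" "snd (f y)" y'] * by simp
  qed
  have img: "f ` Y \<subseteq> {1, -1} \<times> ?S"
    using f unfolding image_subset_iff mem_Times_iff by blast
  have fin: "finite ({1, -1 :: real} \<times> ?S)"
    using T by simp
  show "finite (polar_vertices T)"
    unfolding Y_def[symmetric] using inj_on_finite[OF inj img fin] .
  have "card Y \<le> card ({1, -1 :: real} \<times> ?S)"
    using card_inj_on_le[OF inj img fin] .
  also have "\<dots> = 2 * card ?S"
    by (simp add: card_cartesian_product)
  finally show "card (polar_vertices T) \<le> 2 * card ?S"
    unfolding Y_def .
qed

text \<open>The supporting hyperplane of a facet misses the interior point \<open>0\<close>, so its equation can be
  normalised to have right-hand side \<open>1\<close>. The facet is the hull of the points of \<open>T\<close> on it, has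
  affine dimension \<open>n - 1\<close>, and its affine hull avoids \<open>0\<close>; adding the origin raises the dimension to
  \<open>n\<close>, so these points span the space.\<close>

lemma facet_polar_vertex:
  fixes T :: "'a::euclidean_space set"
  assumes T: "finite T" and zero: "0 \<in> interior (convex hull T)"
    and F: "F facet_of convex hull T"
  obtains y where "y \<in> polar_vertices T" "F = convex hull T \<inter> {x. y \<bullet> x = 1}"
proof -
  let ?P = "convex hull T"
  have "polyhedron ?P"
    using T by (simp add: polyhedron_convex_hull)
  then obtain a b where ab: "a \<noteq> 0" "?P \<subseteq> {x. a \<bullet> x \<le> b}" "F = ?P \<inter> {x. a \<bullet> x = b}"
    using facet_of_polyhedron[OF _ F] by metis
  have "0 \<in> interior {x. a \<bullet> x \<le> b}"
    using zero ab(2) interior_mono by blast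
  then have b: "b > 0"
    using ab(1) by (simp add: interior_halfspace_le)
  define y where "y = a /\<^sub>R b"
  have le: "a \<bullet> x \<le> b \<longleftrightarrow> y \<bullet> x \<le> 1" and eq: "a \<bullet> x = b \<longleftrightarrow> y \<bullet> x = 1" for x
    using b by (auto simp: y_def field_simps)
  let ?A = "{x\<in>T. y \<bullet> x = 1}"
  have Fy: "F = ?P \<inter> {x. y \<bullet> x = 1}"
    using ab(3) eq by auto
  have feas: "y \<bullet> x \<le> 1" if "x \<in> T" for x
    using ab(2) le hull_inc[OF that, of convex] by auto
  obtain A' where A': "A' \<subseteq> T" "F = convex hull A'"
    using face_of_convex_hull_subset[OF finite_imp_compact[OF T] facet_of_imp_face_of[OF F]] by blast
  have "A' \<subseteq> ?A"
    using A' Fy hull_subset[of A' convex] by auto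
  then have subspan: "F \<subseteq> span ?A"
    using A'(2) convex_hull_subset_span span_mono by (metis order_trans)
  have dimP: "aff_dim ?P = int DIM('a)"
    using zero aff_dim_nonempty_interior by blast
  have dimF: "aff_dim F = int DIM('a) - 1"
    using F dimP by (simp add: facet_of_def)
  have "0 \<notin> affine hull F"
  proof
    assume "0 \<in> affine hull F"
    moreover have "affine hull F \<subseteq> {x. y \<bullet> x = 1}"
      by (rule hull_minimal) (auto simp: Fy affine_hyperplane)
    ultimately show False by auto
  qed
  then have "aff_dim (insert 0 F) = int DIM('a)"
    using dimF by (simp add: aff_dim_insert)
  then have "dim (insert 0 F) = DIM('a)"
    using aff_dim_zero[of "insert 0 F"] by (simp add: hull_inc)
  then have "dim F = DIM('a)"
    by (metis dim_span span_insert_0)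
  then have "span F = UNIV"
    by (simp add: dim_eq_full)
  then have "span ?A = UNIV"
    using span_minimal[OF subspan subspace_span] by auto
  then show thesis
    using that feas Fy by (auto simp: polar_vertices_def)
qed

lemma card_facets_le_card_small_subsets:
  fixes S :: "'a::euclidean_space set"
  assumes S: "finite S" and full: "aff_dim S = int DIM('a)"
  shows "card {F. F facet_of convex hull S} \<le> 2 * card {K. K \<subseteq> S \<and> card K \<le> DIM('a) div 2}"
proof -
  \<comment> \<open>Translate an interior point to the origin.\<close>
  have "affine hull (convex hull S) = UNIV"
    using full by (simp add: aff_dim_eq_full)
  then have "interior (convex hull S) = rel_interior (convex hull S)"
    by (simp add: rel_interior_interior)
  moreover have "S \<noteq> {}"
    using full by auto
  ultimately have "interior (convex hull S) \<noteq> {}"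
    by (simp add: rel_interior_eq_empty)
  then obtain z where z: "z \<in> interior (convex hull S)" by blast
  let ?t = "\<lambda>x. - z + x"
  define T where "T = ?t ` S"
  have T: "finite T" using S by (simp add: T_def)
  have hull: "convex hull T = ?t ` (convex hull S)"
    by (simp only: T_def convex_hull_translation)
  have zero: "0 \<in> interior (convex hull T)"
    unfolding hull interior_translation using z by force
  have inj: "inj ?t" by (simp add: inj_def)
  then have inj_image: "inj (image ?t)"
    by (intro injI) (simp only: inj_image_eq_iff)
  have "{F. F facet_of convex hull T} \<subseteq> (\<lambda>y. convex hull T \<inter> {x. y \<bullet> x = 1}) ` polar_vertices T"
    using facet_polar_vertex[OF T zero] by blast
  then have "card {F. F facet_of convex hull T} \<le> card (polar_vertices T)"
    using polar_vertices_bound(1)[OF T] surj_card_le by blast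
  also have "\<dots> \<le> 2 * card {K. K \<subseteq> T \<and> card K \<le> DIM('a) div 2}"
    by (rule polar_vertices_bound(2)[OF T])
  also have "{K. K \<subseteq> T \<and> card K \<le> DIM('a) div 2} = image ?t ` {K. K \<subseteq> S \<and> card K \<le> DIM('a) div 2}"
  proof -
    have "card (?t ` K) = card K" for K
      using inj by (simp add: card_image inj_on_subset)
    then show ?thesis
      unfolding T_def by (auto simp: subset_image_iff)
  qed
  also have "card \<dots> = card {K. K \<subseteq> S \<and> card K \<le> DIM('a) div 2}"
    by (rule card_image[OF inj_on_subset[OF inj_image subset_UNIV]])
  also have "card {F. F facet_of convex hull T} = card {F. F facet_of convex hull S}"
  proof -
    have facet: "?t ` F facet_of ?t ` P \<longleftrightarrow> F facet_of P" for F P :: "'a set"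
      unfolding facet_of_def face_of_translation_eq aff_dim_translation_eq by simp
    have "{F. F facet_of convex hull T} = image ?t ` {F. F facet_of convex hull S}"
    proof (intro set_eqI iffI)
      fix F assume F: "F \<in> {F. F facet_of convex hull T}"
      have eq: "F = ?t ` ((+) z ` F)"
        by (simp add: image_image)
      have "(+) z ` F facet_of convex hull S"
        using F eq facet[of "(+) z ` F" "convex hull S"] by (simp add: hull)
      then show "F \<in> image ?t ` {F. F facet_of convex hull S}"
        using eq by blast
    next
      fix F assume "F \<in> image ?t ` {F. F facet_of convex hull S}"
      then show "F \<in> {F. F facet_of convex hull T}"
        unfolding hull using facet by blast
    qed
    then show ?thesis
      by (simp only: card_image[OF inj_on_subset[OF inj_image subset_UNIV]])
  qed
  finally show ?thesis .
qed

lemma card_small_subsets_le: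
  assumes "finite S" "S \<noteq> {}"
  shows "card {K. K \<subseteq> S \<and> card K \<le> k} \<le> (k + 1) * card S ^ k"
proof -
  have "{K. K \<subseteq> S \<and> card K \<le> k} = (\<Union>i\<le>k. {K. K \<subseteq> S \<and> card K = i})"
    by auto
  then have "card {K. K \<subseteq> S \<and> card K \<le> k} \<le> (\<Sum>i\<le>k. card {K. K \<subseteq> S \<and> card K = i})"
    by (simp add: card_UN_le)
  also have "\<dots> \<le> (\<Sum>i\<le>k. card S ^ k)"
  proof (rule sum_mono)
    fix i assume "i \<in> {..k}"
    have "card {K. K \<subseteq> S \<and> card K = i} = card S choose i"
      using n_subsets[OF assms(1)] by simp
    also have "\<dots> \<le> card S ^ i"
      by (cases "i \<le> card S") (simp_all add: binomial_le_pow binomial_eq_0)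
    also have "\<dots> \<le> card S ^ k"
      using \<open>i \<in> {..k}\<close> assms by (intro power_increasing) (auto simp: Suc_le_eq card_gt_0_iff)
    finally show "card {K. K \<subseteq> S \<and> card K = i} \<le> card S ^ k" .
  qed
  finally show ?thesis by simp
qed

lemma num_facets_le:
  fixes xs :: "(real^'n) list"
  assumes "xs \<in> full_samples"
  shows "num_facets xs \<le> 2 * (CARD('n) div 2 + 1) * length xs ^ (CARD('n) div 2)"
proof -
  have xs: "distinct xs" "xs \<noteq> []" "aff_dim (set xs) = int DIM(real^'n)"
    using assms by (auto simp: full_samples_def samples_def)
  have "num_facets xs \<le> 2 * card {K. K \<subseteq> set xs \<and> card K \<le> CARD('n) div 2}"
    using card_facets_le_card_small_subsets[OF finite_set xs(3)]
    by (simp add: num_facets_def facets_def)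
  also have "\<dots> \<le> 2 * ((CARD('n) div 2 + 1) * length xs ^ (CARD('n) div 2))"
    using card_small_subsets_le[of "set xs" "CARD('n) div 2"] xs by (simp add: distinct_card)
  finally show ?thesis by simp
qed

text \<open>The bound depends on the samples through their number only, so it passes to the maximum.\<close>

lemma max_facets_le:
  fixes xs :: "(real^'n) list"
  assumes "xs \<in> full_samples"
  shows "max_facets TYPE('n) (length xs) \<le> 2 * (CARD('n) div 2 + 1) * length xs ^ (CARD('n) div 2)"
proof -
  let ?A = "{num_facets ys | ys :: (real^'n) list. ys \<in> full_samples \<and> length ys = length xs}"
  have le: "m \<le> 2 * (CARD('n) div 2 + 1) * length xs ^ (CARD('n) div 2)" if m: "m \<in> ?A" for m
  proof -
    obtain ys :: "(real^'n) list" where "m = num_facets ys" "ys \<in> full_samples" "length ys = length xs"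
      using m by blast
    then show ?thesis using num_facets_le[of ys] by simp
  qed
  have "finite ?A"
    using le by (intro finite_subset[OF _ finite_atMost]) blast
  moreover have "?A \<noteq> {}" using assms by blast
  ultimately show ?thesis
    unfolding max_facets_def using le by (intro Max.boundedI)
qed


section \<open>Operation counts\<close>

lemma bigo_principal_iff:
  "f \<in> O[principal A](g) \<longleftrightarrow> (\<exists>C>0. \<forall>x\<in>A. norm (f x) \<le> C * norm (g x))"
  by (simp add: bigo_def eventually_principal)

lemma cost_bind_timed: "cost (bind_timed m f) = cost m + cost (f (result m))"
  and result_bind_timed: "result (bind_timed m f) = result (f (result m))"
  by (simp_all add: bind_timed_def split_beta Let_def)

lemma cost_flops: "cost (flops k x) = k" and result_flops: "result (flops k x) = x"
  by (simp_all add: flops_def)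

lemmas timed_simps = cost_bind_timed result_bind_timed cost_flops result_flops

lemma result_map_timed: "result (map_timed f xs) = map (\<lambda>x. result (f x)) xs"
  by (induction xs) (simp_all add: timed_simps)

lemma cost_map_timed: "cost (map_timed f xs) = (\<Sum>x\<leftarrow>xs. cost (f x))"
  by (induction xs) (simp_all add: timed_simps)

lemma result_differences: "result (differences xs) = map (\<lambda>x. x - hd xs) (tl xs)"
  by (simp add: differences_def result_map_timed vec_sub_def timed_simps)

lemma cost_differences:
  fixes xs :: "(real^'n) list"
  shows "cost (differences xs) = CARD('n) * (length xs - 1)"
  by (simp add: differences_def cost_map_timed vec_sub_def timed_simps sum_list_triv)

lemma cost_centroid:
  fixes xs :: "(real^'n) list"
  shows "cost (centroid xs) = CARD('n) * (length xs + 1)"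
proof -
  have "cost (vec_sum xs) = CARD('n) * length xs"
    by (induction xs) (simp_all add: timed_simps)
  then show ?thesis
    by (simp add: centroid_def timed_simps)
qed

lemma cost_halfspace_le:
  fixes R :: "('n::finite) routines"
  shows "cost (halfspace R c V) \<le> cost (facet_normal R V)
    + cost (dot_product R (result (facet_normal R V)) (hd V))
    + cost (dot_product R (result (facet_normal R V)) c) + CARD('n) + 2"
  by (simp add: halfspace_def timed_simps)

text \<open>With a correct rank routine, the test of the algorithm therefore lets exactly the
  full-dimensional samples pass, the inputs on which the other subroutines are specified.\<close>

lemma aff_dim_eq_dim_differences:
  assumes "xs \<noteq> []"
  shows "aff_dim (set xs) = int (dim (set (result (differences xs))))"
proof -
  obtain x ys where xs: "xs = x # ys"
    using assms by (cases xs) auto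
  have "aff_dim (set xs) = int (dim ((\<lambda>v. - x + v) ` set xs))"
    by (rule aff_dim_eq_dim) (simp add: xs hull_inc)
  also have "(\<lambda>v. - x + v) ` set xs = insert 0 (set (result (differences xs)))"
    by (auto simp: xs result_differences)
  finally show ?thesis by (metis dim_span span_insert_0)
qed

lemma quickhull_result:
  assumes "correct_routines R" and xs: "xs \<in> full_samples"
  shows "length (result (quickhull R xs)) = num_facets xs"
    and "set (result (quickhull R xs)) \<subseteq> facet_vertex_lists"
proof -
  obtain Fs where Fs: "distinct Fs" "set Fs = facets xs"
      "list_all2 vertex_list Fs (result (quickhull R xs))"
    using assms unfolding correct_routines_def by blast
  show "length (result (quickhull R xs)) = num_facets xs"
    using Fs by (metis distinct_card list_all2_lengthD num_facets_def)
  show "set (result (quickhull R xs)) \<subseteq> facet_vertex_lists"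
  proof
    fix V assume "V \<in> set (result (quickhull R xs))"
    then obtain F where "F \<in> set Fs" "vertex_list F V"
      using Fs(3) by (metis in_set_conv_nth list_all2_conv_all_nth)
    then show "V \<in> facet_vertex_lists"
      using Fs(2) xs by (auto simp: facet_vertex_lists_def)
  qed
qed

lemma cost_halfspace_representation:
  fixes R :: "('n::finite) routines"
  assumes correct: "correct_routines R" and xs: "xs \<in> samples"
  shows "cost (halfspace_representation R xs) =
    CARD('n) * (length xs - 1) + cost (matrix_rank R (result (differences xs))) +
    (if xs \<in> full_samples
     then cost (quickhull R xs) + CARD('n) * (length xs + 1) +
       (\<Sum>V\<leftarrow>result (quickhull R xs). cost (halfspace R (result (centroid xs)) V))
     else 0)"
proof -
  have "xs \<noteq> []" using xs by (auto simp: samples_def)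
  then have "result (matrix_rank R (result (differences xs))) = CARD('n) \<longleftrightarrow> xs \<in> full_samples"
    using correct xs aff_dim_eq_dim_differences[of xs]
    by (simp add: correct_routines_def full_samples_def)
  then show ?thesis
    by (simp add: halfspace_representation_def timed_simps cost_differences cost_centroid cost_map_timed)
qed

lemma cost_halfspace_representation_bigo:
  fixes R :: "('n::finite) routines"
  assumes correct: "correct_routines R" and model: "cost_model R" and n: "CARD('n) \<in> {2, 3}"
  shows "(\<lambda>xs. real (cost (halfspace_representation R xs))) \<in> O[principal samples](\<lambda>xs.
    real CARD('n) ^ 2 * real (length xs) + real (length xs) ^ 2
    + real CARD('n) * real (length xs) + real (num_facets xs) * real CARD('n) ^ 3)"
proof -
  let ?n = "real CARD('n)"
  obtain cd where cd: "cd > 0" "\<And>x y. real (cost (dot_product R x y)) \<le> cd * ?n"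
    using model unfolding cost_model_def bigo_principal_iff by auto
  obtain cr where cr: "cr > 0" "\<And>xs. xs \<in> samples \<Longrightarrow>
      real (cost (matrix_rank R (result (differences xs)))) \<le> cr * (?n ^ 2 * real (length xs))"
    using model unfolding cost_model_def bigo_principal_iff by auto
  obtain cn where cn: "cn > 0" "\<And>V. V \<in> facet_vertex_lists \<Longrightarrow>
      real (cost (facet_normal R V)) \<le> cn * ?n ^ 3"
    using model unfolding cost_model_def bigo_principal_iff by auto
  obtain cq where cq: "cq > 0" "\<And>xs. xs \<in> full_samples \<Longrightarrow>
      real (cost (quickhull R xs)) \<le> cq * real (length xs) ^ 2"
    using model n unfolding cost_model_def bigo_principal_iff by auto
  \<comment> \<open>\<open>ch * n ^ 3\<close> bounds the work for one facet: its normal vector, two dot products, and the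
    remaining \<open>n + 2\<close> operations, which are at most \<open>3 * n ^ 3\<close>. The differences and the centroid
    together take at most \<open>3 * n * N\<close> operations, which \<open>ch\<close> covers as well.\<close>
  define ch where "ch = cn + 2 * cd + 3"
  define C where "C = cr + cq + ch"
  have n1: "?n \<ge> 1" by (simp add: Suc_le_eq)
  have half: "real (cost (halfspace R c V)) \<le> ch * ?n ^ 3" if V: "V \<in> facet_vertex_lists" for c V
  proof -
    have "real (cost (halfspace R c V)) \<le> cn * ?n ^ 3 + 2 * cd * ?n + ?n + 2"
      using cost_halfspace_le[of R c V] cn(2)[OF V]
        cd(2)[of "result (facet_normal R V)" "hd V"] cd(2)[of "result (facet_normal R V)" c]
      by linarith
    moreover have "?n \<le> ?n ^ 3" "1 \<le> ?n ^ 3"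
      using n1 power_increasing[of 1 3 ?n] one_le_power[of ?n 3] by auto
    moreover have "2 * cd * ?n \<le> 2 * cd * ?n ^ 3"
      using cd(1) \<open>?n \<le> ?n ^ 3\<close> by simp
    ultimately show ?thesis
      unfolding ch_def distrib_right by linarith
  qed
  have "real (cost (halfspace_representation R xs)) \<le>
      C * (?n ^ 2 * real (length xs) + real (length xs) ^ 2
        + ?n * real (length xs) + real (num_facets xs) * ?n ^ 3)"
    if xs: "xs \<in> samples" for xs
  proof -
    let ?N = "real (length xs)" and ?J = "real (num_facets xs)"
    have N: "?N \<ge> 1" using xs by (auto simp: samples_def)
    have full: "real (cost (quickhull R xs) + CARD('n) * (length xs + 1) +
       (\<Sum>V\<leftarrow>result (quickhull R xs). cost (halfspace R (result (centroid xs)) V)))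
        \<le> cq * ?N ^ 2 + 2 * (?n * ?N) + ?J * (ch * ?n ^ 3)" if "xs \<in> full_samples"
    proof -
      let ?Vs = "result (quickhull R xs)"
      have "real (\<Sum>V\<leftarrow>?Vs. cost (halfspace R (result (centroid xs)) V))
          = (\<Sum>V\<leftarrow>?Vs. real (cost (halfspace R (result (centroid xs)) V)))"
        by (simp add: sum_list_of_nat[symmetric] o_def)
      also have "\<dots> \<le> (\<Sum>V\<leftarrow>?Vs. ch * ?n ^ 3)"
        using half quickhull_result(2)[OF correct that] by (intro sum_list_mono) blast
      also have "\<dots> = ?J * (ch * ?n ^ 3)"
        using quickhull_result(1)[OF correct that] by (simp add: sum_list_triv)
      finally have "real (\<Sum>V\<leftarrow>?Vs. cost (halfspace R (result (centroid xs)) V))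
          \<le> ?J * (ch * ?n ^ 3)" .
      moreover have "?n * (?N + 1) \<le> ?n * (2 * ?N)"
        using N n1 by (intro mult_left_mono) auto
      ultimately show ?thesis
        using cq(2)[OF that] unfolding of_nat_add of_nat_mult of_nat_1 by linarith
    qed
    have "real (CARD('n) * (length xs - 1)) \<le> ?n * ?N"
      by simp
    moreover have "cr * (?n ^ 2 * ?N) \<le> C * (?n ^ 2 * ?N)" "cq * ?N ^ 2 \<le> C * ?N ^ 2"
      "3 * (?n * ?N) \<le> C * (?n * ?N)" "ch * (?J * ?n ^ 3) \<le> C * (?J * ?n ^ 3)"
      using cr(1) cq(1) cn(1) cd(1) by (intro mult_right_mono; simp add: C_def ch_def)+
    moreover have "0 \<le> cq * ?N ^ 2" "0 \<le> ?n * ?N" "0 \<le> ch * (?J * ?n ^ 3)"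
      using cq(1) cn(1) cd(1) by (simp_all add: ch_def)
    moreover have "?J * (ch * ?n ^ 3) = ch * (?J * ?n ^ 3)" by simp
    moreover have "real (if xs \<in> full_samples
        then cost (quickhull R xs) + CARD('n) * (length xs + 1) +
          (\<Sum>V\<leftarrow>result (quickhull R xs). cost (halfspace R (result (centroid xs)) V))
        else 0) \<le> cq * ?N ^ 2 + 2 * (?n * ?N) + ch * (?J * ?n ^ 3)" (is "real ?E \<le> _")
      using full calculation by auto
    moreover have "real (cost (halfspace_representation R xs)) = real (CARD('n) * (length xs - 1))
        + real (cost (matrix_rank R (result (differences xs)))) + real ?E"
      unfolding cost_halfspace_representation[OF correct xs] of_nat_add ..
    ultimately show ?thesis
      using cr(2)[OF xs] unfolding distrib_left[of C] by linarith
  qed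
  moreover have "C > 0"
    using cr(1) cq(1) cn(1) cd(1) by (simp add: C_def ch_def)
  ultimately show ?thesis
    unfolding bigo_principal_iff by (intro exI[of _ C]) auto
qed

lemma cost_quickhull_bigo:
  fixes R :: "('n::finite) routines"
  assumes model: "cost_model R" and n: "CARD('n) > 3"
  shows "(\<lambda>xs. real (cost (quickhull R xs)))
    \<in> O[principal full_samples](\<lambda>xs. real (length xs) ^ (CARD('n) div 2))"
proof -
  have "(\<lambda>xs. real (cost (quickhull R xs)))
      \<in> O[principal full_samples](\<lambda>xs. real (max_facets TYPE('n) (length xs)))"
    using model n by (simp add: cost_model_def)
  also have "(\<lambda>xs. real (max_facets TYPE('n) (length xs)))
      \<in> O[principal full_samples](\<lambda>xs::(real^'n) list. real (length xs) ^ (CARD('n) div 2))"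
    unfolding bigo_principal_iff
  proof (intro exI conjI ballI)
    let ?C = "real (2 * (CARD('n) div 2 + 1))"
    show "?C > 0" by simp
    fix xs :: "(real^'n) list" assume "xs \<in> full_samples"
    then have "real (max_facets TYPE('n) (length xs))
        \<le> real (2 * (CARD('n) div 2 + 1) * length xs ^ (CARD('n) div 2))"
      using max_facets_le of_nat_mono by blast
    then show "norm (real (max_facets TYPE('n) (length xs)))
        \<le> ?C * norm (real (length xs) ^ (CARD('n) div 2))"
      by (simp only: of_nat_mult of_nat_power) simp
  qed
  finally show ?thesis .
qed

theorem proposition15:
  fixes R :: "('n::finite) routines"
  assumes "correct_routines R" and "cost_model R"
  shows "(CARD('n) \<in> {2, 3} \<longrightarrow>
            (\<lambda>xs. real (cost (halfspace_representation R xs)))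
              \<in> O[principal samples](\<lambda>xs.
                  real CARD('n) ^ 2 * real (length xs) + real (length xs) ^ 2
                  + real CARD('n) * real (length xs) + real (num_facets xs) * real CARD('n) ^ 3))
       \<and> (CARD('n) > 3 \<longrightarrow>
            (\<lambda>xs. real (cost (quickhull R xs)))
              \<in> O[principal full_samples](\<lambda>xs. real (length xs) ^ (CARD('n) div 2)))"
  using cost_halfspace_representation_bigo[OF assms] cost_quickhull_bigo[OF assms(2)] by blast

end
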